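(* Let $C$ be a null Cartan curve in $\mathbb{R}_1^4$, given by $c:I\to\mathbb{R}_1^4$ with pseudo-arc parameter $s$. If the set $\{c'(s),c''(s),c^{(3)}(s),c^{(4)}(s)\}$ is linearly independent for every $s\in I$, then $C$ is not a null Bertrand curve, i.e. $C$ admits no Bertrand mate.
   Context: $\mathbb{R}_1^4$ is Minkowski spacetime: $\mathbb{R}^4$ with the standard orientation and the metric $\langle x,y\rangle=-x_1y_1+x_2y_2+x_3y_3+x_4y_4$. All curves and functions are smooth and parameters range over open intervals. A null curve $c:I\to\mathbb{R}_1^4$ is a regular curve with $\langle c',c'\rangle=0$ and $c'\neq 0$. It is parametrized by the pseudo-arc parameter $s$ if $\langle c''(s),c''(s)\rangle=1$ for all $s$. A null Cartan curve $C$ in $\mathbb{R}_1^4$ is a null curve $c:I\to\mathbb{R}_1^4$ parametrized by the pseudo-arc parameter $s$ together with its Cartan frame: the positively oriented pseudo-orthonormal frame $\{L,N,W_1,W_2\}$ along $c$, meaning $\langle L,L\rangle=\langle N,N\rangle=0$, $\langle L,N\rangle=1$, $\langle W_i,W_j\rangle=\delta_{ij}$, $\langle L,W_i\rangle=\langle N,W_i\rangle=0$ for $i,j\in\{1,2\}$, with $L=c'$, satisfying the Frenet equations $$L'=W_1,\qquad N'=k_1W_1+k_2W_2,\qquad W_1'=-k_1L-N,\qquad W_2'=-k_2L,$$ where the smooth functions $k_1,k_2:I\to\mathbb{R}$ are the Cartan curvatures. (No condition $k_2\neq 0$ is part of the definition.) The principal normal vector field of $C$ is $W_1$, and the normal line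 at $c(s)$ is the line $\{c(s)+tW_1(s):t\in\mathbb{R}\}$. Let $C$ and $\overline C$ be null Cartan curves in $\mathbb{R}_1^4$, given by $c:I\to\mathbb{R}_1^4$ and $\overline c:\overline I\to\mathbb{R}_1^4$ with pseudo-arc parameters $s$ and $\overline s$, and with Cartan frames $\{L,N,W_1,W_2\}$ and $\{\overline L,\overline N,\overline W_1,\overline W_2\}$. The pair $(C,\overline C)$ is a null Bertrand pair, and $\overline C$ is a Bertrand mate of $C$, if $\overline C$ is distinct from $C$ and there is a smooth map $\varphi:I\to\overline I$, $\overline s=\varphi(s)$, under which the principal normal vector fields are linearly dependent and the normal lines coincide at corresponding points; that is, for all $s\in I$, $\overline W_1(\varphi(s))=\pm W_1(s)$ and the normal line of $\overline C$ at $\overline c(\varphi(s))$ equals the normal line of $C$ at $c(s)$. Here $\overline C$ distinct from $C$ means that $\overline c(\varphi(s))$ is not identically equal to $c(s)$. A null Cartan curve is a null Bertrand curve if it admits a Bertrand mate. *)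

theory Defs
  imports "HOL-Analysis.Analysis"
begin

definition minkowski :: "real ^ 4 \<Rightarrow> real ^ 4 \<Rightarrow> real" where
  "minkowski x y = - (x $ 1 * y $ 1) + x $ 2 * y $ 2 + x $ 3 * y $ 3 + x $ 4 * y $ 4"

text \<open>The four vectors are the rows of the matrix below, in the given order.\<close>

definition positively_oriented :: "real ^ 4 \<Rightarrow> real ^ 4 \<Rightarrow> real ^ 4 \<Rightarrow> real ^ 4 \<Rightarrow> bool" where
  "positively_oriented u v w z \<longleftrightarrow> det (vector [u, v, w, z] :: real ^ 4 ^ 4) > 0"

definition pseudo_orthonormal :: "real ^ 4 \<Rightarrow> real ^ 4 \<Rightarrow> real ^ 4 \<Rightarrow> real ^ 4 \<Rightarrow> bool" where
  "pseudo_orthonormal l n w1 w2 \<longleftrightarrow>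
     minkowski l l = 0 \<and> minkowski n n = 0 \<and> minkowski l n = 1 \<and>
     minkowski w1 w1 = 1 \<and> minkowski w2 w2 = 1 \<and> minkowski w1 w2 = 0 \<and>
     minkowski l w1 = 0 \<and> minkowski l w2 = 0 \<and> minkowski n w1 = 0 \<and> minkowski n w2 = 0"

text \<open>Parameter intervals may be unbounded; they are taken to be nonempty.\<close>

definition open_interval :: "real set \<Rightarrow> bool" where
  "open_interval I \<longleftrightarrow> open I \<and> is_interval I \<and> I \<noteq> {}"

text \<open>Functions are total, but on an open set the iterated derivatives at a point depend only on
  the values of the function near that point, so values outside the parameter interval
  are irrelevant.\<close>

definition nth_deriv :: "nat \<Rightarrow> (real \<Rightarrow> 'a::real_normed_vector) \<Rightarrow> real \<Rightarrow> 'a" where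
  "nth_deriv n f = ((\<lambda>g t. vector_derivative g (at t)) ^^ n) f"

definition smooth_on_open :: "real set \<Rightarrow> (real \<Rightarrow> 'a::real_normed_vector) \<Rightarrow> bool" where
  "smooth_on_open I f \<longleftrightarrow> (\<forall>n. \<forall>t\<in>I. nth_deriv n f differentiable (at t))"

definition null_curve :: "real set \<Rightarrow> (real \<Rightarrow> real ^ 4) \<Rightarrow> bool" where
  "null_curve I c \<longleftrightarrow>
     open_interval I \<and> smooth_on_open I c \<and>
     (\<forall>s\<in>I. minkowski (nth_deriv 1 c s) (nth_deriv 1 c s) = 0 \<and> nth_deriv 1 c s \<noteq> 0)"

definition pseudo_arc_parametrized :: "real set \<Rightarrow> (real \<Rightarrow> real ^ 4) \<Rightarrow> bool" where
  "pseudo_arc_parametrized I c \<longleftrightarrow>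
     (\<forall>s\<in>I. minkowski (nth_deriv 2 c s) (nth_deriv 2 c s) = 1)"

record framed_curve =
  ivl :: "real set"
  crv :: "real \<Rightarrow> real ^ 4"
  frL :: "real \<Rightarrow> real ^ 4"
  frN :: "real \<Rightarrow> real ^ 4"
  frW1 :: "real \<Rightarrow> real ^ 4"
  frW2 :: "real \<Rightarrow> real ^ 4"
  curv1 :: "real \<Rightarrow> real"
  curv2 :: "real \<Rightarrow> real"

definition cartan_frame :: "framed_curve \<Rightarrow> bool" where
  "cartan_frame C \<longleftrightarrow>
     smooth_on_open (ivl C) (frL C) \<and> smooth_on_open (ivl C) (frN C) \<and>
     smooth_on_open (ivl C) (frW1 C) \<and> smooth_on_open (ivl C) (frW2 C) \<and>
     smooth_on_open (ivl C) (curv1 C) \<and> smooth_on_open (ivl C) (curv2 C) \<and>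
     (\<forall>s\<in>ivl C.
        pseudo_orthonormal (frL C s) (frN C s) (frW1 C s) (frW2 C s) \<and>
        positively_oriented (frL C s) (frN C s) (frW1 C s) (frW2 C s) \<and>
        frL C s = nth_deriv 1 (crv C) s \<and>
        (frL C has_vector_derivative frW1 C s) (at s) \<and>
        (frN C has_vector_derivative
           (curv1 C s *\<^sub>R frW1 C s + curv2 C s *\<^sub>R frW2 C s)) (at s) \<and>
        (frW1 C has_vector_derivative (- (curv1 C s *\<^sub>R frL C s) - frN C s)) (at s) \<and>
        (frW2 C has_vector_derivative (- (curv2 C s *\<^sub>R frL C s))) (at s))"

definition null_cartan_curve :: "framed_curve \<Rightarrow> bool" where
  "null_cartan_curve C \<longleftrightarrow>
     null_curve (ivl C) (crv C) \<and> pseudo_arc_parametrized (ivl C) (crv C) \<and> cartan_frame C"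

definition normal_line :: "framed_curve \<Rightarrow> real \<Rightarrow> (real ^ 4) set" where
  "normal_line C s = {crv C s + t *\<^sub>R frW1 C s | t. t \<in> (UNIV :: real set)}"

text \<open>The sign relating the principal normals may a priori depend on \<open>s\<close>, and \<open>\<phi>\<close> is not required
  to be injective, surjective or regular.\<close>

definition null_bertrand_pair :: "framed_curve \<Rightarrow> framed_curve \<Rightarrow> bool" where
  "null_bertrand_pair C D \<longleftrightarrow>
     null_cartan_curve C \<and> null_cartan_curve D \<and>
     (\<exists>\<phi>. smooth_on_open (ivl C) \<phi> \<and> \<phi> ` ivl C \<subseteq> ivl D \<and>
        (\<exists>s\<in>ivl C. crv D (\<phi> s) \<noteq> crv C s) \<and>
        (\<forall>s\<in>ivl C.
           (frW1 D (\<phi> s) = frW1 C s \<or> frW1 D (\<phi> s) = - frW1 C s) \<and>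
           normal_line D (\<phi> s) = normal_line C s))"

definition null_bertrand_curve :: "framed_curve \<Rightarrow> bool" where
  "null_bertrand_curve C \<longleftrightarrow> null_cartan_curve C \<and> (\<exists>D. null_bertrand_pair C D)"

text \<open>The derivatives of orders 1 to 4 are linearly independent as a family: \<^const>\<open>independent\<close> only speaks
  about the set of values, so repetitions are excluded separately.\<close>

definition derivs_independent :: "(real \<Rightarrow> real ^ 4) \<Rightarrow> real \<Rightarrow> bool" where
  "derivs_independent c s \<longleftrightarrow>
     inj_on (\<lambda>i. nth_deriv i c s) {1..4} \<and> independent ((\<lambda>i. nth_deriv i c s) ` {1..4})"

end

theory Submission
  imports Defs
begin

text \<open>Linear independence of the first four derivatives says exactly that the second curvature
  \<open>k\<^sub>2\<close> never vanishes, because \<open>c\<^sup>(\<^sup>4\<^sup>) = - k\<^sub>1' L - 2 k\<^sub>1 W\<^sub>1 - k\<^sub>2 W\<^sub>2\<close> while the lower derivatives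
  span \<open>L\<close>, \<open>W\<^sub>1\<close> and \<open>N\<close> (\<open>curv2_nonzero_if_derivs_independent\<close>). A Bertrand mate, on the other
  hand, forces \<open>k\<^sub>2 = 0\<close>.

  To see this, write the mate as \<open>c + \<alpha> W\<^sub>1\<close>. The tangent vectors of both curves are orthogonal to
  the common normal direction, which makes the offset \<open>\<alpha>\<close> constant (\<open>bertrand_offset_constant\<close>),
  and nonzero as the curves are distinct. Hence the tangent vector of the mate is proportional to
  \<open>(1 - \<alpha> k\<^sub>1) L - \<alpha> N\<close>. It has to be null, and a null vector in the plane of \<open>L\<close> and \<open>N\<close> with
  nonzero \<open>N\<close>-component is a multiple of \<open>N\<close>: the mate travels in the direction of \<open>N\<close>
  (\<open>bertrand_mate_tangent\<close>). So its principal normal is, up to a multiple of \<open>N\<close>, proportional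
  to \<open>N' = k\<^sub>1 W\<^sub>1 + k\<^sub>2 W\<^sub>2\<close>, and this is compatible with the normal being \<open>\<plusminus> W\<^sub>1\<close> only if \<open>k\<^sub>2 = 0\<close>
  (\<open>bertrand_mate_curv2_zero\<close>).\<close>

lemma bounded_bilinear_minkowski: "bounded_bilinear minkowski"
  unfolding bilinear_conv_bounded_bilinear[symmetric] bilinear_def minkowski_def
  by (auto intro!: linearI simp: algebra_simps)

interpretation minkowski: bounded_bilinear minkowski
  by (rule bounded_bilinear_minkowski)

lemma minkowski_commute: "minkowski x y = minkowski y x"
  by (simp add: minkowski_def mult.commute)

lemmas minkowski_simps = minkowski.add_left minkowski.add_right minkowski.diff_left
  minkowski.diff_right minkowski.minus_left minkowski.minus_right minkowski.scaleR_left
  minkowski.scaleR_right minkowski.zero_left minkowski.zero_right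

lemma pseudo_orthonormal_products:
  assumes "pseudo_orthonormal l n w1 w2"
  shows "minkowski l l = 0" "minkowski n n = 0" "minkowski l n = 1" "minkowski n l = 1"
    "minkowski w1 w1 = 1" "minkowski w2 w2 = 1" "minkowski w1 w2 = 0" "minkowski w2 w1 = 0"
    "minkowski l w1 = 0" "minkowski w1 l = 0" "minkowski l w2 = 0" "minkowski w2 l = 0"
    "minkowski n w1 = 0" "minkowski w1 n = 0" "minkowski n w2 = 0" "minkowski w2 n = 0"
  using assms by (auto simp: pseudo_orthonormal_def minkowski_commute[of n l]
      minkowski_commute[of w2 w1] minkowski_commute[of w1 l] minkowski_commute[of w2 l]
      minkowski_commute[of w1 n] minkowski_commute[of w2 n])

lemma nth_deriv_Suc: "nth_deriv (Suc n) f t = vector_derivative (nth_deriv n f) (at t)"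
  by (simp add: nth_deriv_def)

lemma smooth_on_open_has_vector_derivative:
  assumes "smooth_on_open I f" "t \<in> I"
  shows "(f has_vector_derivative nth_deriv 1 f t) (at t)"
proof -
  have "nth_deriv 0 f differentiable (at t)"
    using assms unfolding smooth_on_open_def by blast
  then show ?thesis
    by (simp add: nth_deriv_def vector_derivative_works)
qed

lemma nth_deriv_Suc_eq_on_open:
  assumes "open I" "s \<in> I" "\<And>t. t \<in> I \<Longrightarrow> nth_deriv n f t = g t"
    and "(g has_vector_derivative v) (at s)"
  shows "nth_deriv (Suc n) f s = v"
proof -
  have "(nth_deriv n f has_vector_derivative v) (at s)"
    by (rule has_vector_derivative_transform_within_open[OF assms(4,1,2) assms(3)[symmetric]])
  then show ?thesis
    by (simp add: nth_deriv_Suc vector_derivative_at)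
qed

lemma null_cartan_curve_interval:
  assumes "null_cartan_curve C"
  shows "open (ivl C)" "convex (ivl C)"
  using assms
  by (auto simp: null_cartan_curve_def null_curve_def open_interval_def is_interval_convex)

lemma null_cartan_curve_frame:
  assumes "null_cartan_curve C" "s \<in> ivl C"
  shows "pseudo_orthonormal (frL C s) (frN C s) (frW1 C s) (frW2 C s)"
    and "nth_deriv 1 (crv C) s = frL C s"
    and "(crv C has_vector_derivative frL C s) (at s)"
    and "(frL C has_vector_derivative frW1 C s) (at s)"
    and "(frN C has_vector_derivative
           (curv1 C s *\<^sub>R frW1 C s + curv2 C s *\<^sub>R frW2 C s)) (at s)"
    and "(frW1 C has_vector_derivative (- (curv1 C s *\<^sub>R frL C s) - frN C s)) (at s)"
    and "(frW2 C has_vector_derivative (- (curv2 C s *\<^sub>R frL C s))) (at s)"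
    and "(curv1 C has_vector_derivative nth_deriv 1 (curv1 C) s) (at s)"
proof -
  have "smooth_on_open (ivl C) (crv C)" and C: "cartan_frame C"
    using assms(1) by (auto simp: null_cartan_curve_def null_curve_def)
  note deriv = smooth_on_open_has_vector_derivative[OF this(1) assms(2)]
  show "nth_deriv 1 (crv C) s = frL C s"
    using C assms(2) by (simp add: cartan_frame_def)
  with deriv show "(crv C has_vector_derivative frL C s) (at s)"
    by simp
  show "(curv1 C has_vector_derivative nth_deriv 1 (curv1 C) s) (at s)"
    using C assms(2) unfolding cartan_frame_def
    by (blast intro: smooth_on_open_has_vector_derivative)
qed (use assms in \<open>auto simp: null_cartan_curve_def cartan_frame_def\<close>)

text \<open>The component of the fourth derivative outside the span of the first two is
  \<open>- k\<^sub>2 W\<^sub>2\<close>, so a zero of \<open>k\<^sub>2\<close> makes the family dependent.\<close>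

lemma curv2_nonzero_if_derivs_independent:
  assumes C: "null_cartan_curve C" and s: "s \<in> ivl C"
    and ind: "derivs_independent (crv C) s"
  shows "curv2 C s \<noteq> 0"
proof
  assume k2: "curv2 C s = 0"
  let ?d = "\<lambda>n. nth_deriv n (crv C)" and ?e = "\<lambda>n. nth_deriv n (crv C) s"
  note op = null_cartan_curve_interval(1)[OF C]
  note fr = null_cartan_curve_frame[OF C]
  have d1: "?d 1 t = frL C t" if "t \<in> ivl C" for t
    using fr(2)[OF that] .
  have d2: "?d 2 t = frW1 C t" if "t \<in> ivl C" for t
    using nth_deriv_Suc_eq_on_open[OF op that d1 fr(4)[OF that]] by (simp add: eval_nat_numeral)
  have d3: "?d 3 t = - (curv1 C t *\<^sub>R frL C t) - frN C t" if "t \<in> ivl C" for t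
    using nth_deriv_Suc_eq_on_open[OF op that d2 fr(6)[OF that]] by (simp add: eval_nat_numeral)
  have "((\<lambda>t. - (curv1 C t *\<^sub>R frL C t) - frN C t) has_vector_derivative
      - (curv1 C s *\<^sub>R frW1 C s + nth_deriv 1 (curv1 C) s *\<^sub>R frL C s)
      - (curv1 C s *\<^sub>R frW1 C s + curv2 C s *\<^sub>R frW2 C s)) (at s)"
    by (intro has_vector_derivative_diff has_vector_derivative_minus fr(4,5) s
        bounded_bilinear.has_vector_derivative[OF bounded_bilinear_scaleR] fr(8))
  then have d4: "?d 4 s =
      - (curv1 C s *\<^sub>R frW1 C s + nth_deriv 1 (curv1 C) s *\<^sub>R frL C s) - curv1 C s *\<^sub>R frW1 C s"
    using nth_deriv_Suc_eq_on_open[OF op s d3] k2 by (simp add: eval_nat_numeral)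
  have in_span: "?d 4 s \<in> span {?d 1 s, ?d 2 s}"
    unfolding d4 d1[OF s] d2[OF s]
    by (intro span_diff span_neg span_add span_mul span_base) auto
  have "{?d 1 s, ?d 2 s} \<subseteq> ?e ` {1..4} - {?d 4 s}"
    using ind inj_onD[of ?e "{1..4}" 1 4] inj_onD[of ?e "{1..4}" 2 4]
    unfolding derivs_independent_def by auto
  then have "?d 4 s \<in> span (?e ` {1..4} - {?d 4 s})"
    using in_span span_mono by blast
  then have "dependent (?e ` {1..4})"
    unfolding dependent_def by (intro bexI[of _ "?d 4 s"]) auto
  then show False
    using ind by (simp add: derivs_independent_def)
qed

text \<open>With \<open>\<alpha>\<close> the Minkowski product of the joining vector with \<open>W\<^sub>1\<close>, the derivative of \<open>\<alpha>\<close>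
  involves only products of \<open>W\<^sub>1\<close> with vectors orthogonal to it: the two tangents, and \<open>W\<^sub>1'\<close>.\<close>

lemma bertrand_offset_constant:
  assumes C: "null_cartan_curve C" and D: "null_cartan_curve D"
    and \<phi>: "\<And>s. s \<in> ivl C \<Longrightarrow> (\<phi> has_vector_derivative \<phi>' s) (at s)" "\<phi> ` ivl C \<subseteq> ivl D"
    and normal: "\<And>s. s \<in> ivl C \<Longrightarrow> frW1 D (\<phi> s) = frW1 C s \<or> frW1 D (\<phi> s) = - frW1 C s"
    and line: "\<And>s. s \<in> ivl C \<Longrightarrow> normal_line D (\<phi> s) = normal_line C s"
  obtains \<alpha> where "\<And>s. s \<in> ivl C \<Longrightarrow> crv D (\<phi> s) = crv C s + \<alpha> *\<^sub>R frW1 C s"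
proof -
  define a where "a s = minkowski (crv D (\<phi> s) - crv C s) (frW1 C s)" for s
  have offset: "crv D (\<phi> s) = crv C s + a s *\<^sub>R frW1 C s" if s: "s \<in> ivl C" for s
  proof -
    have "crv D (\<phi> s) \<in> normal_line D (\<phi> s)"
      unfolding normal_line_def by (intro CollectI exI[of _ 0]) simp
    then obtain t where t: "crv D (\<phi> s) = crv C s + t *\<^sub>R frW1 C s"
      unfolding line[OF s] by (auto simp: normal_line_def)
    with pseudo_orthonormal_products[OF null_cartan_curve_frame(1)[OF C s]] have "a s = t"
      by (simp add: a_def minkowski_simps)
    with t show ?thesis by simp
  qed
  have "(a has_vector_derivative 0) (at s)" if s: "s \<in> ivl C" for s
  proof -
    have \<phi>s: "\<phi> s \<in> ivl D"
      using \<phi>(2) s by blast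
    note C_prod = pseudo_orthonormal_products[OF null_cartan_curve_frame(1)[OF C s]]
    note D_prod = pseudo_orthonormal_products[OF null_cartan_curve_frame(1)[OF D \<phi>s]]
    have tangent: "minkowski (frL D (\<phi> s)) (frW1 C s) = 0"
      using normal[OF s] D_prod by (auto simp: minkowski_simps)
    have mate: "((\<lambda>s. crv D (\<phi> s)) has_vector_derivative \<phi>' s *\<^sub>R frL D (\<phi> s)) (at s)"
      using vector_diff_chain_at[OF \<phi>(1)[OF s] null_cartan_curve_frame(3)[OF D \<phi>s]]
      by (simp add: o_def)
    have "(a has_vector_derivative
        minkowski (crv D (\<phi> s) - crv C s) (- (curv1 C s *\<^sub>R frL C s) - frN C s) +
        minkowski (\<phi>' s *\<^sub>R frL D (\<phi> s) - frL C s) (frW1 C s)) (at s)"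
      unfolding a_def
      by (intro minkowski.has_vector_derivative has_vector_derivative_diff mate
          null_cartan_curve_frame(3,6)[OF C s])
    then show ?thesis
      unfolding offset[OF s] by (simp add: minkowski_simps tangent C_prod)
  qed
  then obtain \<alpha> where "\<And>s. s \<in> ivl C \<Longrightarrow> a s = \<alpha>"
    using has_vector_derivative_zero_constant[OF null_cartan_curve_interval(2)[OF C], of a]
      has_vector_derivative_at_within by blast
  with offset show thesis by (intro that[of \<alpha>]) simp
qed

text \<open>The tangent \<open>(1 - \<alpha> k\<^sub>1) L - \<alpha> N\<close> of the offset curve has square
  \<open>- 2 \<alpha> (1 - \<alpha> k\<^sub>1)\<close>, so nullity removes the \<open>L\<close>-component.\<close>

lemma bertrand_mate_tangent:
  assumes C: "null_cartan_curve C" and D: "null_cartan_curve D"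
    and s: "s \<in> ivl C" and \<phi>s: "\<phi> s \<in> ivl D" and \<phi>: "(\<phi> has_vector_derivative p) (at s)"
    and offset: "\<And>t. t \<in> ivl C \<Longrightarrow> crv D (\<phi> t) = crv C t + \<alpha> *\<^sub>R frW1 C t"
    and "\<alpha> \<noteq> 0"
  shows "p *\<^sub>R frL D (\<phi> s) = - (\<alpha> *\<^sub>R frN C s)"
proof -
  note fr = null_cartan_curve_frame[OF C s]
  note C_prod = pseudo_orthonormal_products[OF fr(1)]
  note D_prod = pseudo_orthonormal_products[OF null_cartan_curve_frame(1)[OF D \<phi>s]]
  have "((\<lambda>t. crv D (\<phi> t)) has_vector_derivative p *\<^sub>R frL D (\<phi> s)) (at s)"
    using vector_diff_chain_at[OF \<phi> null_cartan_curve_frame(3)[OF D \<phi>s]] by (simp add: o_def)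
  then have "((\<lambda>t. crv C t + \<alpha> *\<^sub>R frW1 C t) has_vector_derivative p *\<^sub>R frL D (\<phi> s)) (at s)"
    by (rule has_vector_derivative_transform_within_open
        [OF _ null_cartan_curve_interval(1)[OF C] s offset])
  moreover have "((\<lambda>t. crv C t + \<alpha> *\<^sub>R frW1 C t) has_vector_derivative
      frL C s + \<alpha> *\<^sub>R (- (curv1 C s *\<^sub>R frL C s) - frN C s)) (at s)"
    by (intro has_vector_derivative_add fr(3)
        bounded_linear.has_vector_derivative[OF bounded_linear_scaleR_right] fr(6))
  ultimately have "p *\<^sub>R frL D (\<phi> s) = frL C s + \<alpha> *\<^sub>R (- (curv1 C s *\<^sub>R frL C s) - frN C s)"
    by (rule vector_derivative_unique_at)
  then have tangent: "p *\<^sub>R frL D (\<phi> s) = (1 - \<alpha> * curv1 C s) *\<^sub>R frL C s - \<alpha> *\<^sub>R frN C s"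
    by (simp add: algebra_simps)
  have "0 = minkowski (p *\<^sub>R frL D (\<phi> s)) (p *\<^sub>R frL D (\<phi> s))"
    by (simp add: minkowski_simps D_prod)
  also have "\<dots> = - 2 * \<alpha> * (1 - \<alpha> * curv1 C s)"
    unfolding tangent by (simp add: minkowski_simps C_prod)
  finally have "1 - \<alpha> * curv1 C s = 0"
    using \<open>\<alpha> \<noteq> 0\<close> by simp
  with tangent show ?thesis by simp
qed

text \<open>The tangent of the mate is a multiple of \<open>N\<close>, hence orthogonal to \<open>W\<^sub>2\<close> all along the curve.
  Differentiating this relation instead of the tangent itself needs only the first derivative of
  the correspondence \<open>\<phi>\<close>, and is insensitive to a sign change of the normals.\<close>

lemma bertrand_mate_curv2_zero:
  assumes pair: "null_bertrand_pair C D" and s: "s \<in> ivl C"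
  shows "curv2 C s = 0"
proof -
  obtain \<phi> where C: "null_cartan_curve C" and D: "null_cartan_curve D"
    and smooth: "smooth_on_open (ivl C) \<phi>" and \<phi>: "\<phi> ` ivl C \<subseteq> ivl D"
    and distinct: "\<exists>t\<in>ivl C. crv D (\<phi> t) \<noteq> crv C t"
    and normal: "\<And>t. t \<in> ivl C \<Longrightarrow> frW1 D (\<phi> t) = frW1 C t \<or> frW1 D (\<phi> t) = - frW1 C t"
    and line: "\<And>t. t \<in> ivl C \<Longrightarrow> normal_line D (\<phi> t) = normal_line C t"
    using pair unfolding null_bertrand_pair_def by blast
  note \<phi>' = smooth_on_open_has_vector_derivative[OF smooth]
  obtain \<alpha> where offset: "\<And>t. t \<in> ivl C \<Longrightarrow> crv D (\<phi> t) = crv C t + \<alpha> *\<^sub>R frW1 C t"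
    using bertrand_offset_constant[OF C D \<phi>' \<phi> normal line] by blast
  have "\<alpha> \<noteq> 0"
    using distinct offset by auto
  have \<phi>_in: "\<phi> t \<in> ivl D" if "t \<in> ivl C" for t
    using \<phi> that by blast
  have tangent: "nth_deriv 1 \<phi> t *\<^sub>R frL D (\<phi> t) = - (\<alpha> *\<^sub>R frN C t)" if "t \<in> ivl C" for t
    using bertrand_mate_tangent[OF C D that \<phi>_in[OF that] \<phi>'[OF that] offset \<open>\<alpha> \<noteq> 0\<close>] .
  note C_prod = pseudo_orthonormal_products[OF null_cartan_curve_frame(1)[OF C]]
  have scaled: "nth_deriv 1 \<phi> t * minkowski (frL D (\<phi> t)) x = - \<alpha> * minkowski (frN C t) x"
    if "t \<in> ivl C" for t x
    using arg_cong[OF tangent[OF that], of "\<lambda>y. minkowski y x"] by (simp add: minkowski_simps)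
  have regular: "nth_deriv 1 \<phi> t \<noteq> 0" and L_L: "minkowski (frL D (\<phi> t)) (frL C t) \<noteq> 0"
    if "t \<in> ivl C" for t
    using scaled[OF that, of "frL C t"] C_prod[OF that] \<open>\<alpha> \<noteq> 0\<close> by auto
  have L_W2: "minkowski (frL D (\<phi> t)) (frW2 C t) = 0" if "t \<in> ivl C" for t
    using scaled[OF that, of "frW2 C t"] C_prod[OF that] regular[OF that] by simp
  have W1_W2: "minkowski (frW1 D (\<phi> s)) (frW2 C s) = 0"
    using normal[OF s] C_prod[OF s] by (auto simp: minkowski_simps)

  have "((\<lambda>t. frL D (\<phi> t)) has_vector_derivative nth_deriv 1 \<phi> s *\<^sub>R frW1 D (\<phi> s)) (at s)"
    using vector_diff_chain_at[OF \<phi>'[OF s] null_cartan_curve_frame(4)[OF D \<phi>_in[OF s]]]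
    by (simp add: o_def)
  then have "((\<lambda>t. minkowski (frL D (\<phi> t)) (frW2 C t)) has_vector_derivative
      minkowski (frL D (\<phi> s)) (- (curv2 C s *\<^sub>R frL C s)) +
      minkowski (nth_deriv 1 \<phi> s *\<^sub>R frW1 D (\<phi> s)) (frW2 C s)) (at s)"
    by (intro minkowski.has_vector_derivative null_cartan_curve_frame(7)[OF C s])
  moreover have "((\<lambda>t. minkowski (frL D (\<phi> t)) (frW2 C t)) has_vector_derivative 0) (at s)"
    by (rule has_vector_derivative_transform_within_open[OF has_vector_derivative_const
          null_cartan_curve_interval(1)[OF C] s L_W2[symmetric]])
  ultimately have "minkowski (frL D (\<phi> s)) (- (curv2 C s *\<^sub>R frL C s)) +
      minkowski (nth_deriv 1 \<phi> s *\<^sub>R frW1 D (\<phi> s)) (frW2 C s) = 0"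
    by (rule vector_derivative_unique_at)
  then have "curv2 C s * minkowski (frL D (\<phi> s)) (frL C s) = 0"
    by (simp add: minkowski_simps W1_W2)
  with L_L[OF s] show ?thesis by simp
qed

theorem theorem3p1:
  fixes C :: framed_curve
  assumes "null_cartan_curve C"
    and "\<And>s. s \<in> ivl C \<Longrightarrow> derivs_independent (crv C) s"
  shows "\<not> null_bertrand_curve C"
proof
  assume "null_bertrand_curve C"
  then obtain D where "null_bertrand_pair C D"
    by (auto simp: null_bertrand_curve_def)
  moreover obtain s where "s \<in> ivl C"
    using assms(1) by (auto simp: null_cartan_curve_def null_curve_def open_interval_def)
  ultimately show False
    using bertrand_mate_curv2_zero curv2_nonzero_if_derivs_independent assms by blast
qed

end
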